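(* (CbN) In $(\Lambda,\to_\beta)$, $\to_{\ell\ell,\beta}$ is a normalizing strategy for $\to_\beta$. (CbV) In $(\Lambda,\to_{\beta_v})$, $\to_{\ell\ell,\beta_v}$ is a normalizing strategy for $\to_{\beta_v}$.
   Context: Pure $\lambda$-terms: $t ::= x\mid\lambda x.t\mid ts$ (set $\Lambda$); values are variables and abstractions; contexts $c ::= [\cdot]\mid tc\mid ct\mid\lambda x.c$. $\to_\beta$ and $\to_{\beta_v}$ are the contextual closures of $(\lambda x.t)s\mapsto_\beta t[s/x]$ and $(\lambda x.t)v\mapsto_{\beta_v}t[v/x]$ ($v$ value). CbN level: $\mathrm{lev}^n([\cdot])=0$, $\mathrm{lev}^n(\lambda x.c)=\mathrm{lev}^n(ct)=\mathrm{lev}^n(c)$, $\mathrm{lev}^n(tc)=\mathrm{lev}^n(c)+1$. CbV level: $\mathrm{lev}^v([\cdot])=0$, $\mathrm{lev}^v(\lambda x.c)=\mathrm{lev}^v(c)+1$, $\mathrm{lev}^v(ct)=\mathrm{lev}^v(c')$ if $c=\lambda x.c'$ and $\mathrm{lev}^v(c)$ otherwise, $\mathrm{lev}^v(tc)=\mathrm{lev}^v(c)$. The least level of $t$ is the infimum (in $\mathbb{N}\cup\{\infty\}$) of the levels of $c$ over decompositions $t=c[r]$ with $r$ a $\beta$-redex (CbN, using $\mathrm{lev}^n$) or a $\beta_v$-redex (CbV, using $\mathrm{lev}^v$); a step $c[r]\to c[r']$ is least-level ($\to_{\ell\ell,\beta}$, resp. $\to_{\ell\ell,\beta_v}$) if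 the level of $c$ equals the least level of $c[r]$. A strategy $\to_e\subseteq\to$ is normalizing for $\to$ if it has the same normal forms as $\to$ and, whenever $t\to^*u$ with $u$ $\to$-normal, every maximal $\to_e$-sequence from $t$ ends in a normal form. *)

theory Defs
  imports "HOL-Library.Extended_Nat"
begin

section \<open>Lambda terms\<close>

text \<open>Terms up to renaming of bound variables, in de Bruijn notation. Dangling indices are the
  free variables.\<close>

datatype lterm = Var nat | Abs lterm | App lterm lterm

primrec lift :: "lterm \<Rightarrow> nat \<Rightarrow> lterm" where
  "lift (Var i) k = (if i < k then Var i else Var (Suc i))"
| "lift (Abs t) k = Abs (lift t (Suc k))"
| "lift (App t s) k = App (lift t k) (lift s k)"

text \<open>\<open>subst t s k\<close> replaces index \<open>k\<close> by \<open>s\<close> and, since the binder of \<open>k\<close> is consumed,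
  decrements the indices above \<open>k\<close>.\<close>

primrec subst :: "lterm \<Rightarrow> lterm \<Rightarrow> nat \<Rightarrow> lterm" where
  "subst (Var i) s k = (if k < i then Var (i - 1) else if i = k then s else Var i)"
| "subst (Abs t) s k = Abs (subst t (lift s 0) (Suc k))"
| "subst (App t u) s k = App (subst t s k) (subst u s k)"

fun is_value :: "lterm \<Rightarrow> bool" where
  "is_value (Var i) = True"
| "is_value (Abs t) = True"
| "is_value (App t s) = False"

inductive root_beta :: "lterm \<Rightarrow> lterm \<Rightarrow> bool" where
  "root_beta (App (Abs t) s) (subst t s 0)"

inductive root_beta_v :: "lterm \<Rightarrow> lterm \<Rightarrow> bool" where
  "is_value v \<Longrightarrow> root_beta_v (App (Abs t) v) (subst t v 0)"


section \<open>Contexts and reduction\<close>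

datatype ctx = Hole | CAbs ctx | CAppL ctx lterm | CAppR lterm ctx

text \<open>Plugging may capture: no index is lifted under \<open>CAbs\<close>.\<close>

primrec plug :: "ctx \<Rightarrow> lterm \<Rightarrow> lterm" where
  "plug Hole r = r"
| "plug (CAbs c) r = Abs (plug c r)"
| "plug (CAppL c t) r = App (plug c r) t"
| "plug (CAppR t c) r = App t (plug c r)"

definition ctx_closure :: "(lterm \<Rightarrow> lterm \<Rightarrow> bool) \<Rightarrow> lterm \<Rightarrow> lterm \<Rightarrow> bool" where
  "ctx_closure rule t u \<longleftrightarrow> (\<exists>c r r'. rule r r' \<and> t = plug c r \<and> u = plug c r')"

definition beta :: "lterm \<Rightarrow> lterm \<Rightarrow> bool" where
  "beta = ctx_closure root_beta"

definition beta_v :: "lterm \<Rightarrow> lterm \<Rightarrow> bool" where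
  "beta_v = ctx_closure root_beta_v"


section \<open>Least-level reduction\<close>

primrec lev_n :: "ctx \<Rightarrow> nat" where
  "lev_n Hole = 0"
| "lev_n (CAbs c) = lev_n c"
| "lev_n (CAppL c t) = lev_n c"
| "lev_n (CAppR t c) = lev_n c + 1"

text \<open>The equations are tried in order: the fourth one applies only if the left subcontext is not
  an abstraction.\<close>

fun lev_v :: "ctx \<Rightarrow> nat" where
  "lev_v Hole = 0"
| "lev_v (CAbs c) = lev_v c + 1"
| "lev_v (CAppL (CAbs c) t) = lev_v c"
| "lev_v (CAppL c t) = lev_v c"
| "lev_v (CAppR t c) = lev_v c"

text \<open>The least level of a normal form is \<open>Inf {} = \<infinity>\<close>.\<close>

definition least_level :: "(ctx \<Rightarrow> nat) \<Rightarrow> (lterm \<Rightarrow> lterm \<Rightarrow> bool) \<Rightarrow> lterm \<Rightarrow> enat" where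
  "least_level lev rule t = Inf {enat (lev c) |c r. t = plug c r \<and> (\<exists>r'. rule r r')}"

definition least_level_step ::
  "(ctx \<Rightarrow> nat) \<Rightarrow> (lterm \<Rightarrow> lterm \<Rightarrow> bool) \<Rightarrow> lterm \<Rightarrow> lterm \<Rightarrow> bool" where
  "least_level_step lev rule t u \<longleftrightarrow>
     (\<exists>c r r'. rule r r' \<and> t = plug c r \<and> u = plug c r' \<and> enat (lev c) = least_level lev rule t)"

definition ll_beta :: "lterm \<Rightarrow> lterm \<Rightarrow> bool" where
  "ll_beta = least_level_step lev_n root_beta"

definition ll_beta_v :: "lterm \<Rightarrow> lterm \<Rightarrow> bool" where
  "ll_beta_v = least_level_step lev_v root_beta_v"


section \<open>Normalizing strategies\<close>

definition normal_form :: "('a \<Rightarrow> 'a \<Rightarrow> bool) \<Rightarrow> 'a \<Rightarrow> bool" where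
  "normal_form R t \<longleftrightarrow> \<not> (\<exists>u. R t u)"

text \<open>A reduction sequence is given by its number of steps \<open>n\<close>, possibly \<open>\<infinity>\<close>, and a function \<open>f\<close>
  enumerating its elements; values of \<open>f\<close> beyond \<open>n\<close> are irrelevant.\<close>

definition maximal_seq :: "('a \<Rightarrow> 'a \<Rightarrow> bool) \<Rightarrow> 'a \<Rightarrow> enat \<Rightarrow> (nat \<Rightarrow> 'a) \<Rightarrow> bool" where
  "maximal_seq R t n f \<longleftrightarrow>
     f 0 = t \<and> (\<forall>i. enat i < n \<longrightarrow> R (f i) (f (Suc i))) \<and>
     (\<forall>k. n = enat k \<longrightarrow> \<not> (\<exists>u. R (f k) u))"

definition normalizing_strategy :: "('a \<Rightarrow> 'a \<Rightarrow> bool) \<Rightarrow> ('a \<Rightarrow> 'a \<Rightarrow> bool) \<Rightarrow> bool" where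
  "normalizing_strategy E R \<longleftrightarrow>
     (\<forall>t u. E t u \<longrightarrow> R t u) \<and>
     (\<forall>t. normal_form E t \<longleftrightarrow> normal_form R t) \<and>
     (\<forall>t u. R\<^sup>*\<^sup>* t u \<and> normal_form R u \<longrightarrow>
        (\<forall>n f. maximal_seq E t n f \<longrightarrow> (\<exists>k. n = enat k \<and> normal_form R (f k))))"

end

theory Submission imports Defs begin

text \<open>Let \<open>t\<close> reduce in parallel to \<open>u\<close>, and let \<open>t \<rightarrow> t1\<close> be a least-level step, contracting a
  redex of level \<open>n\<close>. Parallel reduction does not decrease the least level. If the redex is among
  those contracted in parallel, it is not inside the argument of another one of them, as it would
  then be of higher level; hence \<open>t1\<close> reduces in parallel to \<open>u\<close> by a development that is shorter by
  one step. Otherwise it has exactly one residual in \<open>u\<close>, of level \<open>n\<close> and thus of least level,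
  which gives \<open>u \<rightarrow> u1\<close> with \<open>t1\<close> reducing in parallel to \<open>u1\<close>. So strong normalization with
  respect to least-level steps is preserved by parallel expansion, and normal forms have it.\<close>

section \<open>Substitution\<close>

lemma lift_lift: "i \<le> k \<Longrightarrow> lift (lift t i) (Suc k) = lift (lift t k) i"
  by (induction t arbitrary: i k) auto

lemma subst_lift [simp]: "subst (lift t k) s k = t"
  by (induction t arbitrary: k s) auto

lemma lift_subst: "k \<le> j \<Longrightarrow> lift (subst t s k) j = subst (lift t (Suc j)) (lift s j) k"
  by (induction t arbitrary: j k s) (auto simp: lift_lift)

lemma lift_subst': "j \<le> k \<Longrightarrow> lift (subst t s k) j = subst (lift t j) (lift s j) (Suc k)"
  by (induction t arbitrary: j k s) (auto simp: lift_lift)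

lemma subst_subst:
  "j \<le> k \<Longrightarrow> subst (subst t u j) s k = subst (subst t (lift s j) (Suc k)) (subst u s k) j"
  by (induction t arbitrary: j k u s) (auto simp: lift_lift lift_subst')

text \<open>The number of copies of the argument that contracting the binder of \<open>k\<close>
  creates; hence its place as a weight in the index of \<open>par\<close>.\<close>

primrec occs :: "lterm \<Rightarrow> nat \<Rightarrow> nat" where
  "occs (Var i) k = (if i = k then 1 else 0)"
| "occs (Abs t) k = occs t (Suc k)"
| "occs (App t s) k = occs t k + occs s k"

lemma occs_lift: "occs (lift t k) j = (if j < k then occs t j else if j = k then 0 else occs t (j - 1))"
proof (induction t arbitrary: j k)
  case (Abs t)
  then show ?case by (cases j) auto
qed auto

lemma occs_subst:
  "occs (subst t s k) j = occs t (if j < k then j else Suc j) + occs t k * occs s j"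
  by (induction t arbitrary: s j k) (auto simp: occs_lift algebra_simps)


section \<open>Parallel reduction\<close>

text \<open>The flag \<open>b\<close> selects call-by-name.\<close>

abbreviation arg_ok :: "bool \<Rightarrow> lterm \<Rightarrow> bool" where
  "arg_ok b s \<equiv> b \<or> is_value s"

text \<open>The index is the number of steps of a development that contracts each redex before those in
  its argument, which therefore count once per copy.\<close>

inductive par :: "bool \<Rightarrow> nat \<Rightarrow> lterm \<Rightarrow> lterm \<Rightarrow> bool" for b where
  Var: "par b 0 (Var i) (Var i)"
| Abs: "par b m t t' \<Longrightarrow> par b m (Abs t) (Abs t')"
| App: "par b m t t' \<Longrightarrow> par b l s s' \<Longrightarrow> par b (m + l) (App t s) (App t' s')"
| Beta: "par b m t t' \<Longrightarrow> par b l s s' \<Longrightarrow> arg_ok b s \<Longrightarrow>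
    par b (Suc (m + occs t' 0 * l)) (App (Abs t) s) (subst t' s' 0)"

inductive_cases par_VarE: "par b m (Var i) u"
inductive_cases par_AbsE: "par b m (Abs t) u"

lemma par_refl: "par b 0 t t"
  by (induction t) (auto intro: par.Var par.Abs par.App[where m = 0 and l = 0, simplified])

lemma is_value_lift [simp]: "is_value (lift t k) = is_value t"
  by (cases t) auto

lemma is_value_subst: "is_value t \<Longrightarrow> is_value s \<Longrightarrow> is_value (subst t s k)"
  by (cases t) auto

lemma arg_ok_par: "par b m s s' \<Longrightarrow> arg_ok b s \<Longrightarrow> arg_ok b s'"
  by (cases s) (auto elim: par_VarE par_AbsE)

lemma par_lift: "par b m t t' \<Longrightarrow> par b m (lift t k) (lift t' k)"
proof (induction arbitrary: k rule: par.induct)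
  case (Beta m t t' l s s')
  have "par b (Suc (m + occs (lift t' (Suc k)) 0 * l)) (App (Abs (lift t (Suc k))) (lift s k))
      (subst (lift t' (Suc k)) (lift s' k) 0)"
    using Beta by (intro par.Beta) auto
  then show ?case by (simp add: occs_lift lift_subst)
qed (auto intro: par.intros)

text \<open>Contract the redexes of \<open>t\<close> first, then those in each of the
  \<open>occs t' k\<close> copies of \<open>s\<close>. In call-by-value, the condition on
  \<open>s\<close> keeps the arguments of contracted redexes values.\<close>

lemma par_subst:
  assumes "par b m t t'" "par b l s s'" "arg_ok b s"
  shows "par b (m + occs t' k * l) (subst t s k) (subst t' s' k)"
  using assms
proof (induction arbitrary: k s s' rule: par.induct)
  case (Var i)
  then show ?case by (auto intro: par.Var)
next
  case (Abs m t t')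
  have "par b (m + occs t' (Suc k) * l) (subst t (lift s 0) (Suc k)) (subst t' (lift s' 0) (Suc k))"
    using Abs by (intro Abs.IH) (auto intro: par_lift)
  then show ?case by (simp add: par.Abs)
next
  case (App m1 t t' m2 u u')
  have "par b ((m1 + occs t' k * l) + (m2 + occs u' k * l))
     (App (subst t s k) (subst u s k)) (App (subst t' s' k) (subst u' s' k))"
    using App by (intro par.App) auto
  then show ?case by (simp add: algebra_simps)
next
  case (Beta m1 t t' m2 u u')
  let ?t' = "subst t' (lift s' 0) (Suc k)"
  have "par b (Suc ((m1 + occs t' (Suc k) * l) + occs ?t' 0 * (m2 + occs u' k * l)))
     (App (Abs (subst t (lift s 0) (Suc k))) (subst u s k)) (subst ?t' (subst u' s' k) 0)"
    using Beta.prems Beta.hyps(3)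
    by (intro par.Beta Beta.IH) (auto intro: par_lift is_value_subst)
  \<comment> \<open>Index 0 does not occur in \<open>lift s' 0\<close>, so it occurs equally often
    in \<open>?t'\<close> and \<open>t'\<close>; with this the indices agree.\<close>
  then show ?case by (simp add: occs_subst occs_lift subst_subst algebra_simps)
qed

lemma par_plug: "par b m r r' \<Longrightarrow> \<exists>m. par b m (plug c r) (plug c r')"
  by (induction c) (use par_refl in \<open>fastforce intro: par.intros\<close>)+

lemma par_root: "arg_ok b s \<Longrightarrow> \<exists>m. par b m (App (Abs t) s) (subst t s 0)"
  using par.Beta par_refl by blast

lemma beta_par: "beta t u \<Longrightarrow> \<exists>m. par True m t u"
  by (auto simp: beta_def ctx_closure_def elim!: root_beta.cases) (metis par_plug par_root)

lemma beta_v_par: "beta_v t u \<Longrightarrow> \<exists>m. par False m t u"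
  by (auto simp: beta_v_def ctx_closure_def elim!: root_beta_v.cases) (metis par_plug par_root)

text \<open>A parallel step can turn an operator into an abstraction only by contracting a redex at
  its root. That redex has level 0, so no level below the least one arises.\<close>

lemma par_to_Abs:
  assumes "par b m t (Abs u)"
  obtains t' where "t = Abs t'" | p q where "t = App (Abs p) q" "arg_ok b q"
  using assms by (cases rule: par.cases) auto

lemma par_to_value:
  assumes "par b m t u" "is_value u"
  obtains "is_value t" | p q where "t = App (Abs p) q" "arg_ok b q"
  using assms by (cases rule: par.cases) auto


section \<open>Normalizing strategies by shortening developments\<close>

text \<open>Induction on the accessibility of \<open>u\<close> and, within it, on the index: an
  \<open>E\<close>-step of \<open>t\<close> either lowers the index with \<open>u\<close> fixed or
  makes \<open>u\<close> step as well. Thus termination of \<open>E\<close> passes from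
  \<open>u\<close> back to \<open>t\<close>, and so along a whole \<open>R\<close>-sequence from its
  normal form.\<close>

lemma normalizing_strategyI:
  fixes E R :: "'a \<Rightarrow> 'a \<Rightarrow> bool" and P :: "nat \<Rightarrow> 'a \<Rightarrow> 'a \<Rightarrow> bool"
  assumes sub: "\<And>t u. E t u \<Longrightarrow> R t u"
    and nf: "\<And>t u. R t u \<Longrightarrow> \<exists>u. E t u"
    and par: "\<And>t u. R t u \<Longrightarrow> \<exists>m. P m t u"
    and proj: "\<And>m t u t1. P m t u \<Longrightarrow> E t t1 \<Longrightarrow>
      (\<exists>m'<m. P m' t1 u) \<or> (\<exists>u1 m'. E u u1 \<and> P m' t1 u1)"
  shows "normalizing_strategy E R"
proof -
  have nf_iff: "normal_form E t \<longleftrightarrow> normal_form R t" for t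
    unfolding normal_form_def using sub nf by blast
  have expand: "P m t u \<Longrightarrow> Wellfounded.accp E\<inverse>\<inverse> t" if "Wellfounded.accp E\<inverse>\<inverse> u" for m t u
    using that
  proof (induction arbitrary: m t rule: accp.induct)
    case outer: (accI u)
    from outer.prems show ?case
    proof (induction m arbitrary: t rule: less_induct)
      case (less m)
      show ?case
      proof (rule accpI)
        fix t1 assume "E\<inverse>\<inverse> t1 t"
        with proj[OF less.prems] less.IH outer.IH show "Wellfounded.accp E\<inverse>\<inverse> t1"
          by blast
      qed
    qed
  qed
  have acc: "Wellfounded.accp E\<inverse>\<inverse> t" if "R\<^sup>*\<^sup>* t u" "normal_form R u" for t u
    using that
  proof (induction rule: converse_rtranclp_induct)
    case base
    then have "\<not> E u t1" for t1 using nf_iff[of u] by (auto simp: normal_form_def)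
    then show ?case by (blast intro: accpI[of "E\<inverse>\<inverse>" u])
  next
    case (step t t')
    then show ?case using par expand by blast
  qed
  have fin: "\<not> (f 0 = t \<and> (\<forall>i. E (f i) (f (Suc i))))" if "Wellfounded.accp E\<inverse>\<inverse> t" for t and f :: "nat \<Rightarrow> 'a"
    using that
  proof (induction arbitrary: f rule: accp.induct)
    case (accI t)
    show ?case
    proof
      assume *: "f 0 = t \<and> (\<forall>i. E (f i) (f (Suc i)))"
      then have "E\<inverse>\<inverse> (f (Suc 0)) t" by auto
      from accI.IH[OF this, of "\<lambda>i. f (Suc i)"] * show False by auto
    qed
  qed
  have "\<exists>k. n = enat k \<and> normal_form R (f k)"
    if "R\<^sup>*\<^sup>* t u" "normal_form R u" "maximal_seq E t n f" for t u n f
  proof (cases n)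
    case (enat k)
    then show ?thesis using that(3) nf_iff[of "f k"] by (auto simp: maximal_seq_def normal_form_def)
  next
    case infinity
    then show ?thesis using fin[OF acc[OF that(1,2)], of f] that(3) by (auto simp: maximal_seq_def)
  qed
  then show ?thesis
    unfolding normalizing_strategy_def using sub nf_iff by blast
qed


section \<open>Levels\<close>

definition step_at ::
  "(ctx \<Rightarrow> nat) \<Rightarrow> (lterm \<Rightarrow> lterm \<Rightarrow> bool) \<Rightarrow> nat \<Rightarrow> lterm \<Rightarrow> lterm \<Rightarrow> bool" where
  "step_at lev rule n t u \<longleftrightarrow>
     (\<exists>c r r'. rule r r' \<and> t = plug c r \<and> u = plug c r' \<and> lev c = n)"

text \<open>The relation is a parameter so as to fit \<open>step_at\<close> and its inductive forms
  alike. Normal forms satisfy every bound, in accordance with their infinite least level.\<close>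

definition level_ge :: "(nat \<Rightarrow> lterm \<Rightarrow> lterm \<Rightarrow> bool) \<Rightarrow> nat \<Rightarrow> lterm \<Rightarrow> bool" where
  "level_ge S n t \<longleftrightarrow> (\<forall>k u. S k t u \<longrightarrow> n \<le> k)"

lemma level_geD: "level_ge S n t \<Longrightarrow> S k t u \<Longrightarrow> n \<le> k"
  by (auto simp: level_ge_def)

lemma le_least_level_iff: "enat n \<le> least_level lev rule t \<longleftrightarrow> level_ge (step_at lev rule) n t"
  unfolding least_level_def le_Inf_iff level_ge_def step_at_def by fastforce

text \<open>No redex has a level below the infimum, so equality with it amounts to being a lower
  bound.\<close>

lemma least_level_step_iff:
  "least_level_step lev rule t u \<longleftrightarrow>
    (\<exists>n. step_at lev rule n t u \<and> level_ge (step_at lev rule) n t)"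
proof -
  have "enat (lev c) = least_level lev rule t \<longleftrightarrow> enat (lev c) \<le> least_level lev rule t"
    if "rule r r'" "t = plug c r" for c r r'
  proof -
    have "least_level lev rule t \<le> enat (lev c)"
      unfolding least_level_def using that by (intro Inf_lower) blast
    then show ?thesis by auto
  qed
  then show ?thesis
    unfolding least_level_step_def le_least_level_iff[symmetric] step_at_def by metis
qed

lemma least_level_step_imp_closure: "least_level_step lev rule t u \<Longrightarrow> ctx_closure rule t u"
  by (auto simp: least_level_step_def ctx_closure_def)

lemma closure_imp_least_level_step:
  assumes "ctx_closure rule t u"
  shows "\<exists>u. least_level_step lev rule t u"
proof -
  let ?P = "\<lambda>n. \<exists>u. step_at lev rule n t u"
  have "\<exists>n. ?P n" using assms by (auto simp: ctx_closure_def step_at_def)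
  then have "?P (Least ?P)" by (rule LeastI_ex)
  moreover have "level_ge (step_at lev rule) (Least ?P) t"
    by (auto simp: level_ge_def intro: Least_le)
  ultimately show ?thesis unfolding least_level_step_iff by blast
qed

text \<open>Both sides share the level \<open>n\<close>: by \<open>mono\<close>, a step of level
  \<open>n\<close> from \<open>u\<close> is again least-level.\<close>

lemma normalizing_least_level:
  fixes P :: "nat \<Rightarrow> lterm \<Rightarrow> lterm \<Rightarrow> bool"
  assumes par: "\<And>t u. ctx_closure rule t u \<Longrightarrow> \<exists>m. P m t u"
    and mono: "\<And>m n t u. P m t u \<Longrightarrow> level_ge (step_at lev rule) n t \<Longrightarrow>
      level_ge (step_at lev rule) n u"
    and proj: "\<And>m n t u t1. P m t u \<Longrightarrow> step_at lev rule n t t1 \<Longrightarrow>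
      level_ge (step_at lev rule) n t \<Longrightarrow>
      (\<exists>m'<m. P m' t1 u) \<or> (\<exists>u1 m'. step_at lev rule n u u1 \<and> P m' t1 u1)"
  shows "normalizing_strategy (least_level_step lev rule) (ctx_closure rule)"
proof (rule normalizing_strategyI[of _ _ P])
  fix m t u t1 assume "P m t u" "least_level_step lev rule t t1"
  then show "(\<exists>m'<m. P m' t1 u) \<or> (\<exists>u1 m'. least_level_step lev rule u u1 \<and> P m' t1 u1)"
    unfolding least_level_step_iff using mono proj by meson
qed (auto intro: least_level_step_imp_closure closure_imp_least_level_step par)


section \<open>Call-by-name\<close>

text \<open>Contexts are absorbed into the rules, so that steps can be inverted along the rules of
  \<open>par\<close>.\<close>

inductive step_n :: "nat \<Rightarrow> lterm \<Rightarrow> lterm \<Rightarrow> bool" where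
  Beta: "step_n 0 (App (Abs t) s) (subst t s 0)"
| Abs: "step_n n t t' \<Longrightarrow> step_n n (Abs t) (Abs t')"
| AppL: "step_n n t t' \<Longrightarrow> step_n n (App t s) (App t' s)"
| AppR: "step_n n s s' \<Longrightarrow> step_n (Suc n) (App t s) (App t s')"

inductive_cases step_n_VarE: "step_n n (Var i) u"
inductive_cases step_n_AbsE: "step_n n (Abs t) u"

lemma step_n_AppE:
  assumes "step_n n (App t s) u"
  obtains (root) p where "t = Abs p" "n = 0" "u = subst p s 0"
  | (op) t' where "step_n n t t'" "u = App t' s"
  | (arg) k s' where "step_n k s s'" "n = Suc k" "u = App t s'"
  using assms by (cases rule: step_n.cases) auto

lemma step_at_n: "step_at lev_n root_beta = step_n"
proof (intro ext iffI)
  fix n t u assume "step_at lev_n root_beta n t u"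
  then obtain c r r' where "root_beta r r'" "t = plug c r" "u = plug c r'" "lev_n c = n"
    by (auto simp: step_at_def)
  then show "step_n n t u"
    by (induction c arbitrary: n t u) (auto elim!: root_beta.cases intro: step_n.intros)
next
  fix n t u assume "step_n n t u"
  then show "step_at lev_n root_beta n t u"
    unfolding step_at_def
  proof induction
    case (Beta t s)
    show ?case by (rule exI[of _ Hole]) (auto intro: root_beta.intros)
  next
    case (Abs n t t')
    then show ?case by (metis lev_n.simps(2) plug.simps(2))
  next
    case (AppL n t t' s)
    then show ?case by (metis lev_n.simps(3) plug.simps(3))
  next
    case (AppR n s s' t)
    then show ?case by (metis lev_n.simps(4) plug.simps(4) Suc_eq_plus1)
  qed
qed

lemma level_ge_n_Abs: "level_ge step_n n (Abs t) \<longleftrightarrow> level_ge step_n n t"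
  unfolding level_ge_def by (metis step_n.Abs step_n_AbsE)

text \<open>A root redex has level 0. Truncated subtraction makes the condition on the argument
  trivial at \<open>n = 0\<close>.\<close>

lemma level_ge_n_App:
  "level_ge step_n n (App t s) \<longleftrightarrow>
    level_ge step_n n t \<and> level_ge step_n (n - 1) s \<and> (n = 0 \<or> \<not> (\<exists>t'. t = Abs t'))"
proof
  assume ge: "level_ge step_n n (App t s)"
  have "level_ge step_n n t"
    using ge by (auto simp: level_ge_def intro: step_n.AppL)
  moreover have "level_ge step_n (n - 1) s"
    unfolding level_ge_def using level_geD[OF ge step_n.AppR] by fastforce
  moreover have "n = 0" if "t = Abs t'" for t'
    using level_geD[OF ge] that step_n.Beta[of t' s] by blast
  ultimately show "level_ge step_n n t \<and> level_ge step_n (n - 1) s \<and> (n = 0 \<or> \<not> (\<exists>t'. t = Abs t'))"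
    by blast
next
  assume "level_ge step_n n t \<and> level_ge step_n (n - 1) s \<and> (n = 0 \<or> \<not> (\<exists>t'. t = Abs t'))"
  then show "level_ge step_n n (App t s)"
    by (fastforce simp: level_ge_def elim!: step_n_AppE)
qed

lemma level_ge_n_par: "par True m t u \<Longrightarrow> level_ge step_n n t \<Longrightarrow> level_ge step_n n u"
proof (induction arbitrary: n rule: par.induct)
  case (App m t t' l s s')
  \<comment> \<open>If \<open>t'\<close> is an abstraction, either \<open>t\<close> is one and
    \<open>App t s\<close> is a redex, or \<open>t\<close> itself is a redex: level 0 in both
    cases.\<close>
  have "n = 0 \<or> \<not> (\<exists>u. t' = Abs u)"
    using App(1,5) by (auto simp: level_ge_n_App elim: par_to_Abs)
  then show ?case using App by (auto simp: level_ge_n_App)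
\<comment> \<open>For \<open>Beta\<close>, the root redex forces \<open>n = 0\<close>, where the
  bound is trivial.\<close>
qed (auto simp: level_ge_n_Abs level_ge_n_App level_ge_def[of _ 0])

text \<open>Substitution leaves the path to the redex intact, and call-by-name levels depend on
  nothing else.\<close>

lemma step_n_subst: "step_n n t t' \<Longrightarrow> step_n n (subst t s k) (subst t' s k)"
proof (induction arbitrary: s k rule: step_n.induct)
  case (Beta t u)
  then show ?case by (simp add: subst_subst step_n.Beta)
qed (auto intro: step_n.intros)

lemma par_step_n:
  assumes "par True m t u" "step_n n t t1" "level_ge step_n n t"
  shows "(\<exists>m'<m. par True m' t1 u) \<or> (\<exists>u1 m'. step_n n u u1 \<and> par True m' t1 u1)"
  using assms
proof (induction arbitrary: n t1 rule: par.induct)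
  case (Var i)
  then show ?case by (auto elim: step_n_VarE)
next
  case (Abs m t t')
  from Abs.prems(1) obtain t2 where t2: "step_n n t t2" "t1 = Abs t2" by (auto elim: step_n_AbsE)
  with Abs.IH[OF t2(1)] Abs.prems show ?case
    by (auto simp: level_ge_n_Abs intro: par.Abs step_n.Abs)
next
  case (App m t t' l s s')
  note ge = App.prems(2)[unfolded level_ge_n_App]
  from App.prems(1) show ?case
  proof (cases rule: step_n_AppE)
    case (root p)
    \<comment> \<open>The root redex is not contracted in parallel; its residual is the root of
      \<open>App t' s'\<close>.\<close>
    then obtain p' where p': "t' = Abs p'" "par True m p p'"
      using App.hyps(1) by (auto elim: par_AbsE)
    then have "par True (m + occs p' 0 * l) (subst p s 0) (subst p' s' 0)"
      using App.hyps by (intro par_subst) auto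
    then show ?thesis using root p' step_n.Beta by blast
  next
    case (op t2)
    with App.IH(1)[OF op(1)] ge App.hyps show ?thesis
      by (metis par.App step_n.AppL add_less_mono1)
  next
    case (arg k s2)
    with App.IH(2)[OF arg(1)] ge App.hyps show ?thesis
      by (metis par.App step_n.AppR add_less_mono1 add.commute diff_Suc_1)
  qed
next
  case (Beta m t t' l s s')
  \<comment> \<open>The root redex has level 0, so the least level is 0; this rules out steps in the
    argument.\<close>
  then have "n = 0" by (auto simp: level_ge_n_App)
  from Beta.prems(1) show ?case
  proof (cases rule: step_n_AppE)
    case (root p)
    \<comment> \<open>The index from \<open>par_subst\<close> is that of \<open>Beta\<close> without
      the \<open>Suc\<close>.\<close>
    then show ?thesis using par_subst[OF Beta.hyps] by auto
  next
    case (op t2)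
    then obtain t3 where t3: "step_n n t t3" "t2 = Abs t3" by (auto elim: step_n_AbsE)
    have "level_ge step_n n t" using Beta.prems by (auto simp: level_ge_n_App level_ge_n_Abs)
    from Beta.IH(1)[OF t3(1) this] show ?thesis
    proof (elim disjE exE conjE)
      fix m' assume "m' < m" "par True m' t3 t'"
      \<comment> \<open>The target \<open>t'\<close> is fixed, so the number of copies is too, and
        the index drops with \<open>m'\<close>.\<close>
      then have "par True (Suc (m' + occs t' 0 * l)) t1 (subst t' s' 0)"
        using op t3 Beta.hyps by (auto intro: par.Beta)
      then show ?thesis using \<open>m' < m\<close> by (metis add_less_mono1 Suc_less_eq)
    next
      fix u1 m' assume "step_n n t' u1" "par True m' t3 u1"
      \<comment> \<open>Here \<open>occs u1 0\<close> may differ from \<open>occs t' 0\<close>, but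
        the second alternative allows any index.\<close>
      then show ?thesis using op t3 par.Beta[OF _ Beta.hyps(2,3)] step_n_subst by blast
    qed
  next
    case (arg k s2)
    then show ?thesis using \<open>n = 0\<close> by simp
  qed
qed


section \<open>Call-by-value\<close>

text \<open>\<open>AppAbs\<close> enters the body of an operator without counting its binder. The
  side condition of \<open>AppL\<close> prevents reaching the same body through \<open>Abs\<close>
  at a higher level.\<close>

inductive step_v :: "nat \<Rightarrow> lterm \<Rightarrow> lterm \<Rightarrow> bool" where
  Beta: "is_value v \<Longrightarrow> step_v 0 (App (Abs t) v) (subst t v 0)"
| Abs: "step_v n t t' \<Longrightarrow> step_v (Suc n) (Abs t) (Abs t')"
| AppAbs: "step_v n t t' \<Longrightarrow> step_v n (App (Abs t) s) (App (Abs t') s)"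
| AppL: "step_v n t t' \<Longrightarrow> \<not> is_value t \<Longrightarrow> step_v n (App t s) (App t' s)"
| AppR: "step_v n s s' \<Longrightarrow> step_v n (App t s) (App t s')"

inductive_cases step_v_VarE: "step_v n (Var i) u"
inductive_cases step_v_AbsE: "step_v n (Abs t) u"

lemma step_v_AppE:
  assumes "step_v n (App t s) u"
  obtains (root) p where "t = Abs p" "n = 0" "is_value s" "u = subst p s 0"
  | (body) p p' where "step_v n p p'" "t = Abs p" "u = App (Abs p') s"
  | (op) t' where "step_v n t t'" "\<not> is_value t" "u = App t' s"
  | (arg) s' where "step_v n s s'" "u = App t s'"
  using assms by (cases rule: step_v.cases) auto

lemma lev_v_AppL: "\<not> (\<exists>c'. c = CAbs c') \<Longrightarrow> lev_v (CAppL c t) = lev_v c"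
  by (cases c) auto

lemma step_at_v: "step_at lev_v root_beta_v = step_v"
proof (intro ext iffI)
  fix n t u assume "step_at lev_v root_beta_v n t u"
  then obtain c r r' where "root_beta_v r r'" "t = plug c r" "u = plug c r'" "lev_v c = n"
    by (auto simp: step_at_def)
  then show "step_v n t u"
  proof (induction c arbitrary: n t u)
    case (CAppL c s)
    show ?case
    proof (cases "\<exists>c'. c = CAbs c'")
      case True
      then obtain c' where c': "c = CAbs c'" by blast
      \<comment> \<open>Inverting this step of the whole abstraction removes the binder and its
        level, as \<open>AppAbs\<close> requires.\<close>
      have "step_v (Suc (lev_v c')) (plug c r) (plug c r')"
        using CAppL.IH[OF CAppL.prems(1) refl refl refl] c' by simp
      then show ?thesis using CAppL.prems c' by (auto elim: step_v_AbsE intro: step_v.AppAbs)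
    next
      case False
      have "\<not> is_value (plug c r)"
        using False CAppL.prems(1) by (cases c) (auto elim: root_beta_v.cases)
      then show ?thesis
        using CAppL.IH[OF CAppL.prems(1) refl refl refl] CAppL.prems lev_v_AppL[OF False]
        by (auto intro: step_v.AppL)
    qed
  qed (auto elim!: root_beta_v.cases intro: step_v.intros)
next
  fix n t u assume "step_v n t u"
  then show "step_at lev_v root_beta_v n t u"
    unfolding step_at_def
  proof induction
    case (Beta v t)
    then show ?case by (intro exI[of _ Hole]) (auto intro: root_beta_v.intros)
  next
    case (Abs n t t')
    then show ?case by (metis lev_v.simps(2) plug.simps(2) Suc_eq_plus1)
  next
    case (AppAbs n t t' s)
    then show ?case by (metis lev_v.simps(3) plug.simps(2,3))
  next
    case (AppL n t t' s)
    then obtain c r r' where c: "root_beta_v r r'" "t = plug c r" "t' = plug c r'" "lev_v c = n"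
      by blast
    then have "lev_v (CAppL c s) = n" using AppL(2) by (subst lev_v_AppL) auto
    then show ?case using c by (metis plug.simps(3))
  next
    case (AppR n s s' t)
    then show ?case by (metis lev_v.simps(7) plug.simps(4))
  qed
qed

lemma level_ge_v_Abs: "level_ge step_v n (Abs t) \<longleftrightarrow> level_ge step_v (n - 1) t"
proof
  assume ge: "level_ge step_v n (Abs t)"
  show "level_ge step_v (n - 1) t"
    unfolding level_ge_def using level_geD[OF ge step_v.Abs] by fastforce
next
  assume "level_ge step_v (n - 1) t"
  then show "level_ge step_v n (Abs t)"
    by (fastforce simp: level_ge_def elim!: step_v_AbsE)
qed

lemma level_ge_v_AppAbs:
  "level_ge step_v n (App (Abs t) s) \<longleftrightarrow>
    level_ge step_v n t \<and> level_ge step_v n s \<and> (n = 0 \<or> \<not> is_value s)"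
proof
  assume ge: "level_ge step_v n (App (Abs t) s)"
  then have "level_ge step_v n t" "level_ge step_v n s"
    by (auto simp: level_ge_def intro: step_v.AppAbs step_v.AppR)
  moreover have "n = 0" if "is_value s"
    using level_geD[OF ge step_v.Beta[OF that]] by simp
  ultimately show "level_ge step_v n t \<and> level_ge step_v n s \<and> (n = 0 \<or> \<not> is_value s)"
    by blast
next
  assume "level_ge step_v n t \<and> level_ge step_v n s \<and> (n = 0 \<or> \<not> is_value s)"
  then show "level_ge step_v n (App (Abs t) s)"
    by (auto simp: level_ge_def elim!: step_v_AppE)
qed

lemma level_ge_v_App:
  assumes "\<not> (\<exists>t'. t = Abs t')"
  shows "level_ge step_v n (App t s) \<longleftrightarrow> level_ge step_v n t \<and> level_ge step_v n s"
proof
  assume ge: "level_ge step_v n (App t s)"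
  have "n \<le> k" if "step_v k t t'" for k t'
  proof -
    have "\<not> is_value t" using that assms by (cases t) (auto elim: step_v_VarE)
    then show ?thesis using level_geD[OF ge] step_v.AppL that by blast
  qed
  moreover have "level_ge step_v n s"
    using ge by (auto simp: level_ge_def intro: step_v.AppR)
  ultimately show "level_ge step_v n t \<and> level_ge step_v n s"
    by (auto simp: level_ge_def)
next
  assume "level_ge step_v n t \<and> level_ge step_v n s"
  then show "level_ge step_v n (App t s)"
    using assms by (auto simp: level_ge_def elim!: step_v_AppE)
qed

lemma level_ge_v_par: "par False m t u \<Longrightarrow> level_ge step_v n t \<Longrightarrow> level_ge step_v n u"
proof (induction arbitrary: n rule: par.induct)
  case (App m t t' l s s')
  show ?case
  proof (cases "\<exists>p. t = Abs p")
    case True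
    then obtain p p' where p: "t = Abs p" "t' = Abs p'" "par False m p p'"
      using App.hyps by (auto elim: par_AbsE)
    with App.prems have ge: "level_ge step_v n p" "level_ge step_v n s" "n = 0 \<or> \<not> is_value s"
      by (auto simp: level_ge_v_AppAbs)
    have "level_ge step_v n p'"
      \<comment> \<open>The induction hypothesis concerns the whole abstraction, whose binder turns
        the bound \<open>n\<close> for \<open>p\<close> into \<open>Suc n\<close>.\<close>
      using App.IH(1)[of "Suc n"] ge p by (simp add: level_ge_v_Abs)
    \<comment> \<open>If \<open>s'\<close> is newly a value, then \<open>s\<close> was a redex, of
      level 0 in argument position.\<close>
    moreover have "n = 0 \<or> \<not> is_value s'"
      using App.hyps(2) ge by (auto simp: level_ge_v_AppAbs elim: par_to_value)
    ultimately show ?thesis using p App.IH(2) ge by (simp add: level_ge_v_AppAbs)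
  next
    case False
    then have ge: "level_ge step_v n t" "level_ge step_v n s"
      using App.prems by (auto simp: level_ge_v_App)
    have "n = 0 \<or> \<not> (\<exists>p. t' = Abs p)"
      using App.hyps(1) ge False by (auto simp: level_ge_v_AppAbs elim: par_to_Abs)
    then show ?thesis
      using App.IH ge by (auto simp: level_ge_v_App level_ge_def[of _ 0])
  qed
qed (auto simp: level_ge_v_Abs level_ge_v_AppAbs level_ge_def[of _ 0])

lemma step_v_0_not_value: "step_v 0 t t' \<Longrightarrow> \<not> is_value t"
  by (cases t) (auto elim: step_v_VarE step_v_AbsE)

text \<open>Substitution may move an abstraction into operator position and thus decrease positive
  levels.\<close>

lemma step_v_0_subst:
  "step_v 0 t t' \<Longrightarrow> is_value s \<Longrightarrow> step_v 0 (subst t s k) (subst t' s k)"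
proof (induction "0::nat" t t' arbitrary: s k rule: step_v.induct)
  case (Beta v t)
  then show ?case by (simp add: subst_subst step_v.Beta is_value_subst)
next
  case (AppL t t' u)
  from AppL(1,4) AppL.hyps(2)[of s k] have "step_v 0 (subst t s k) (subst t' s k)" by auto
  \<comment> \<open>The step of level 0 just derived shows that \<open>subst t s k\<close> is no
    value, as \<open>AppL\<close> requires.\<close>
  then show ?case using step_v_0_not_value by (auto intro: step_v.AppL)
qed (auto intro: step_v.intros)

lemma par_step_v:
  assumes "par False m t u" "step_v n t t1" "level_ge step_v n t"
  shows "(\<exists>m'<m. par False m' t1 u) \<or> (\<exists>u1 m'. step_v n u u1 \<and> par False m' t1 u1)"
  using assms
proof (induction arbitrary: n t1 rule: par.induct)
  case (Var i)
  then show ?case by (auto elim: step_v_VarE)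
next
  case (Abs m t t')
  from Abs.prems(1) obtain k t2 where t2: "step_v k t t2" "t1 = Abs t2" "n = Suc k"
    by (auto elim: step_v_AbsE)
  with Abs.IH[OF t2(1)] Abs.prems show ?case
    by (auto simp: level_ge_v_Abs intro: par.Abs step_v.Abs)
next
  case (App m t t' l s s')
  from App.prems(1) show ?case
  proof (cases rule: step_v_AppE)
    case (root p)
    then obtain p' where p': "t' = Abs p'" "par False m p p'"
      using App.hyps(1) by (auto elim: par_AbsE)
    then have "par False (m + occs p' 0 * l) (subst p s 0) (subst p' s' 0)"
      using App.hyps root by (intro par_subst) auto
    moreover have "is_value s'" using root arg_ok_par[OF App.hyps(2)] by auto
    ultimately show ?thesis using root p' step_v.Beta by blast
  next
    case (body p p1)
    \<comment> \<open>The induction hypothesis is about \<open>t\<close> including its binder, hence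
      \<open>Suc n\<close>.\<close>
    have "step_v (Suc n) t (Abs p1)" "level_ge step_v (Suc n) t"
      using body App.prems by (auto simp: level_ge_v_AppAbs level_ge_v_Abs intro: step_v.Abs)
    from App.IH(1)[OF this] show ?thesis
    proof (elim disjE exE conjE)
      fix m' assume "m' < m" "par False m' (Abs p1) t'"
      then show ?thesis using body par.App[OF _ App.hyps(2)] by (metis add_less_mono1)
    next
      fix u1 m' assume u1: "step_v (Suc n) t' u1" "par False m' (Abs p1) u1"
      obtain p' where "t' = Abs p'" using body App.hyps(1) by (auto elim: par_AbsE)
      with u1 obtain p2 where "t' = Abs p'" "u1 = Abs p2" "step_v n p' p2"
        by (auto elim: step_v_AbsE)
      then show ?thesis using body u1 par.App[OF _ App.hyps(2)] step_v.AppAbs by blast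
    qed
  next
    case (op t2)
    then have ge: "level_ge step_v n t" using App.prems by (subst (asm) level_ge_v_App) auto
    from App.IH(1)[OF op(1) ge] show ?thesis
    proof (elim disjE exE conjE)
      fix m' assume "m' < m" "par False m' t2 t'"
      then show ?thesis using op par.App[OF _ App.hyps(2)] by (metis add_less_mono1)
    next
      fix u1 m' assume u1: "step_v n t' u1" "par False m' t2 u1"
      \<comment> \<open>At \<open>n = 0\<close> the step itself excludes a value. For positive
        \<open>n\<close>, a value \<open>t'\<close> would stem from a redex \<open>t\<close> of
        level 0, below the least level.\<close>
      have "\<not> is_value t'"
      proof (cases n)
        case 0
        then show ?thesis using u1 step_v_0_not_value by simp
      next
        case (Suc k)
        then show ?thesis
          using App.hyps(1) ge op by (auto simp: level_ge_v_AppAbs elim: par_to_value)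
      qed
      then show ?thesis using op u1 par.App[OF _ App.hyps(2)] step_v.AppL by blast
    qed
  next
    case (arg s2)
    have "level_ge step_v n s"
      using App.prems(2) by (cases t) (auto simp: level_ge_v_App level_ge_v_AppAbs)
    from App.IH(2)[OF arg(1) this] arg App.hyps show ?thesis
      by (metis par.App step_v.AppR nat_add_left_cancel_less)
  qed
next
  case (Beta m t t' l s s')
  then have "n = 0" and ge: "level_ge step_v n t" by (auto simp: level_ge_v_AppAbs)
  have s': "is_value s'" using arg_ok_par[OF Beta.hyps(2,3)] by simp
  from Beta.prems(1) show ?case
  proof (cases rule: step_v_AppE)
    case (root p)
    then show ?thesis using par_subst[OF Beta.hyps] by auto
  next
    case (body t2 t3)
    then have "step_v n t t3" by simp
    from Beta.IH(1)[OF this ge] show ?thesis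
    proof (elim disjE exE conjE)
      fix m' assume "m' < m" "par False m' t3 t'"
      then have "par False (Suc (m' + occs t' 0 * l)) t1 (subst t' s' 0)"
        using body Beta.hyps by (auto intro: par.Beta)
      then show ?thesis using \<open>m' < m\<close> by (metis add_less_mono1 Suc_less_eq)
    next
      \<comment> \<open>Substitution preserves only steps of level 0, which suffices as the root
        redex forces \<open>n = 0\<close>.\<close>
      fix u1 m' assume "step_v n t' u1" "par False m' t3 u1"
      then show ?thesis
        using body par.Beta[OF _ Beta.hyps(2,3)] step_v_0_subst s' \<open>n = 0\<close> by blast
    qed
  next
    case (op t2)
    then show ?thesis by simp
  next
    case (arg s2)
    \<comment> \<open>The argument is a value, and steps inside a value have positive level.\<close>
    then show ?thesis using \<open>n = 0\<close> step_v_0_not_value Beta.hyps(3) by blast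
  qed
qed

theorem theorem4:
  "normalizing_strategy ll_beta beta \<and> normalizing_strategy ll_beta_v beta_v"
proof
  show "normalizing_strategy ll_beta beta"
    unfolding ll_beta_def beta_def
    by (rule normalizing_least_level[of _ "par True"])
      (fact beta_par[unfolded beta_def] level_ge_n_par[folded step_at_n]
        par_step_n[folded step_at_n])+
  show "normalizing_strategy ll_beta_v beta_v"
    unfolding ll_beta_v_def beta_v_def
    by (rule normalizing_least_level[of _ "par False"])
      (fact beta_v_par[unfolded beta_v_def] level_ge_v_par[folded step_at_v]
        par_step_v[folded step_at_v])+
qed

end
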